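(* Let $\Gamma=F\wr\mathbb{Z}^d$ for a non-trivial finite group $F$ and an integer $d\ge2$. Then $[\Gamma]=0$ in $H_0^f(\Gamma)$, where $f(t)=1+t^{1/d}$.
   Context: The (restricted) wreath product is $G\wr H=\left(\bigoplus_{h\in H}G\right)\rtimes H$, where $H$ acts on $\bigoplus_{h\in H}G$ by translation of coordinates. The finitely generated group $\Gamma$ carries a word length metric (here denoted $d(\cdot,\cdot)$) of a finite symmetric generating set, with base point the identity $e$. For $\overline{x}=(x_0,\dots,x_n)\in\Gamma^{n+1}$ put $|\overline{x}|=\max_id(x_i,e)$, and $d(\overline{x},\overline{y})=\max_id(x_i,y_i)$. For a non-decreasing $f:[0,\infty)\to[0,\infty)$ with $f(0)=1$ such that for every $K>0$ there is $L>0$ with $f(t+K)\le Lf(t)$ and $f(Kt)\le Lf(t)$ for all $t>0$, $C_n^f(\Gamma)$ is the real vector space of functions $c:\Gamma^{n+1}\to\mathbb{R}$ (also written as formal sums of simplices) that are alternating (a permutation of the vertices multiplies the value by its sign), have finite propagation (there is $R$ with $c_{\overline{x}}=0$ whenever $d(\overline{x},\Delta_{n+1})\ge R$, where $\Delta_{n+1}$ is the diagonal), and satisfy $|c_{\overline{x}}|\le K_cf(|\overline{x}|)$ for a constant $K_c$ depending on $c$. The differential is the linear extension of $\partial[x_0,\dots,x_n]=\sum_i(-1)^i[x_0,\dots,\hat{x_i},\dots,x_n]$ (each simplex counted once up to reordering of its vertices); on functions, $(\partial c)(y_0,\dots,y_{n-1})=\sum_{z}c(z,y_0,\dots,y_{n-1})$,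 in particular $\partial\psi(x)=\sum_y\psi(y,x)$ for a $1$-chain. $H_*^f(\Gamma)$ is the homology of this complex, and $[\Gamma]\in H_0^f(\Gamma)$ is the class of $\sum_{x\in\Gamma}[x]$. *)

theory Defs
  imports Complex_Main "HOL-Algebra.Algebra" "HOL-Combinatorics.Permutations"
begin

section \<open>Restricted wreath products\<close>

definition semidirect_product ::
    "('n, 'x) monoid_scheme \<Rightarrow> ('h, 'y) monoid_scheme \<Rightarrow> ('h \<Rightarrow> 'n \<Rightarrow> 'n) \<Rightarrow> ('n \<times> 'h) monoid"
  where "semidirect_product N H \<alpha> =
    \<lparr>carrier = carrier N \<times> carrier H,
     monoid.mult = (\<lambda>(a, h) (b, k). (a \<otimes>\<^bsub>N\<^esub> \<alpha> h b, h \<otimes>\<^bsub>H\<^esub> k)),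
     one = (\<one>\<^bsub>N\<^esub>, \<one>\<^bsub>H\<^esub>)\<rparr>"

definition translation_action ::
    "('h, 'y) monoid_scheme \<Rightarrow> 'h \<Rightarrow> ('h \<Rightarrow> 'g) \<Rightarrow> ('h \<Rightarrow> 'g)"
  where "translation_action H h \<phi> = (\<lambda>x\<in>carrier H. \<phi> (inv\<^bsub>H\<^esub> h \<otimes>\<^bsub>H\<^esub> x))"

text \<open>The library's \<open>sum_group\<close> is the direct sum: functions of finite support.\<close>

definition wreath_product ::
    "('g, 'x) monoid_scheme \<Rightarrow> ('h, 'y) monoid_scheme \<Rightarrow> (('h \<Rightarrow> 'g) \<times> 'h) monoid"
  where "wreath_product G H =
    semidirect_product (sum_group (carrier H) (\<lambda>_. G)) H (translation_action H)"

definition int_power_group :: "nat \<Rightarrow> (nat \<Rightarrow> int) monoid"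
  where "int_power_group d = product_group {..<d} (\<lambda>_. integer_group)"

lemma group_int_power_group: "group (int_power_group d)"
  by (simp add: int_power_group_def)

lemma group_semidirect_product:
  assumes N: "group N" and H: "group H"
    and hom: "\<And>h. h \<in> carrier H \<Longrightarrow> \<alpha> h \<in> hom N N"
    and one: "\<And>a. a \<in> carrier N \<Longrightarrow> \<alpha> \<one>\<^bsub>H\<^esub> a = a"
    and comp: "\<And>h k a. \<lbrakk>h \<in> carrier H; k \<in> carrier H; a \<in> carrier N\<rbrakk>
                 \<Longrightarrow> \<alpha> (h \<otimes>\<^bsub>H\<^esub> k) a = \<alpha> h (\<alpha> k a)"
  shows "group (semidirect_product N H \<alpha>)"
proof -
  interpret N: group N by (rule N)
  interpret H: group H by (rule H)
  have cl: "\<alpha> h a \<in> carrier N" if "h \<in> carrier H" "a \<in> carrier N" for h a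
    using hom[OF that(1)] that(2) by (auto simp: hom_def)
  have mul: "\<alpha> h (a \<otimes>\<^bsub>N\<^esub> b) = \<alpha> h a \<otimes>\<^bsub>N\<^esub> \<alpha> h b"
    if "h \<in> carrier H" "a \<in> carrier N" "b \<in> carrier N" for h a b
    using hom[OF that(1)] that by (auto simp: hom_def)
  show ?thesis
  proof (rule groupI)
    fix x assume "x \<in> carrier (semidirect_product N H \<alpha>)"
    then obtain a h where x: "x = (a, h)" and a: "a \<in> carrier N" and h: "h \<in> carrier H"
      by (auto simp: semidirect_product_def)
    let ?y = "(\<alpha> (inv\<^bsub>H\<^esub> h) (inv\<^bsub>N\<^esub> a), inv\<^bsub>H\<^esub> h)"
    have "?y \<in> carrier (semidirect_product N H \<alpha>)"
      using a h cl by (simp add: semidirect_product_def)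
    moreover have "\<alpha> (inv\<^bsub>H\<^esub> h) (inv\<^bsub>N\<^esub> a) \<otimes>\<^bsub>N\<^esub> \<alpha> (inv\<^bsub>H\<^esub> h) a = \<one>\<^bsub>N\<^esub>"
    proof -
      have "\<alpha> (inv\<^bsub>H\<^esub> h) (inv\<^bsub>N\<^esub> a) \<otimes>\<^bsub>N\<^esub> \<alpha> (inv\<^bsub>H\<^esub> h) a = \<alpha> (inv\<^bsub>H\<^esub> h) \<one>\<^bsub>N\<^esub>"
        using a h by (simp add: mul[symmetric])
      also have "\<dots> = \<one>\<^bsub>N\<^esub>"
        using hom_one[OF hom[of "inv\<^bsub>H\<^esub> h"] N N] h by simp
      finally show ?thesis .
    qed
    ultimately show "\<exists>y\<in>carrier (semidirect_product N H \<alpha>).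
        y \<otimes>\<^bsub>semidirect_product N H \<alpha>\<^esub> x = \<one>\<^bsub>semidirect_product N H \<alpha>\<^esub>"
      using x h by (intro bexI[of _ ?y]) (auto simp: semidirect_product_def)
  qed (auto simp: semidirect_product_def cl mul one comp N.m_assoc H.m_assoc)
qed

lemma group_wreath_product:
  assumes G: "group G" and H: "group H"
  shows "group (wreath_product G H)"
  unfolding wreath_product_def
proof (rule group_semidirect_product)
  interpret G: group G by (rule G)
  interpret H: group H by (rule H)
  show "group (sum_group (carrier H) (\<lambda>_. G))" using G by simp
  show "group H" by (rule H)
  show "translation_action H h \<in> hom (sum_group (carrier H) (\<lambda>_. G)) (sum_group (carrier H) (\<lambda>_. G))"
    if h: "h \<in> carrier H" for h
  proof (rule homI)
    fix \<phi> assume "\<phi> \<in> carrier (sum_group (carrier H) (\<lambda>_. G))"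
    then have \<phi>: "\<phi> \<in> carrier H \<rightarrow>\<^sub>E carrier G" and fin: "finite {x \<in> carrier H. \<phi> x \<noteq> \<one>\<^bsub>G\<^esub>}"
      using G by (auto simp: carrier_sum_group)
    have "{x \<in> carrier H. \<phi> (inv\<^bsub>H\<^esub> h \<otimes>\<^bsub>H\<^esub> x) \<noteq> \<one>\<^bsub>G\<^esub>}
        \<subseteq> (\<lambda>x. h \<otimes>\<^bsub>H\<^esub> x) ` {x \<in> carrier H. \<phi> x \<noteq> \<one>\<^bsub>G\<^esub>}"
    proof
      fix x assume x: "x \<in> {x \<in> carrier H. \<phi> (inv\<^bsub>H\<^esub> h \<otimes>\<^bsub>H\<^esub> x) \<noteq> \<one>\<^bsub>G\<^esub>}"
      then have "x = h \<otimes>\<^bsub>H\<^esub> (inv\<^bsub>H\<^esub> h \<otimes>\<^bsub>H\<^esub> x)"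
        using h by (simp add: H.m_assoc[symmetric])
      with x h show "x \<in> (\<lambda>x. h \<otimes>\<^bsub>H\<^esub> x) ` {x \<in> carrier H. \<phi> x \<noteq> \<one>\<^bsub>G\<^esub>}"
        by (intro image_eqI[of _ _ "inv\<^bsub>H\<^esub> h \<otimes>\<^bsub>H\<^esub> x"]) auto
    qed
    then have "finite {x \<in> carrier H. \<phi> (inv\<^bsub>H\<^esub> h \<otimes>\<^bsub>H\<^esub> x) \<noteq> \<one>\<^bsub>G\<^esub>}"
      using fin finite_surj by blast
    then have "finite {x \<in> carrier H. translation_action H h \<phi> x \<noteq> \<one>\<^bsub>G\<^esub>}"
      by (rule rev_finite_subset) (auto simp: translation_action_def)
    then show "translation_action H h \<phi> \<in> carrier (sum_group (carrier H) (\<lambda>_. G))"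
      using \<phi> h G by (auto simp: carrier_sum_group translation_action_def)
  next
    fix \<phi> \<psi>
    show "translation_action H h (\<phi> \<otimes>\<^bsub>sum_group (carrier H) (\<lambda>_. G)\<^esub> \<psi>)
        = translation_action H h \<phi> \<otimes>\<^bsub>sum_group (carrier H) (\<lambda>_. G)\<^esub> translation_action H h \<psi>"
      using h by (auto simp: translation_action_def)
  qed
  show "translation_action H \<one>\<^bsub>H\<^esub> \<phi> = \<phi>"
    if "\<phi> \<in> carrier (sum_group (carrier H) (\<lambda>_. G))" for \<phi>
    using that G by (auto simp: carrier_sum_group translation_action_def PiE_def extensional_def)
  show "translation_action H (h \<otimes>\<^bsub>H\<^esub> k) \<phi> = translation_action H h (translation_action H k \<phi>)"
    if "h \<in> carrier H" "k \<in> carrier H" for h k \<phi>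
    using that by (auto simp: translation_action_def H.inv_mult_group H.m_assoc)
qed


section \<open>Word metrics\<close>

definition finite_symmetric_generating_set :: "('g, 'x) monoid_scheme \<Rightarrow> 'g set \<Rightarrow> bool"
  where "finite_symmetric_generating_set G S \<longleftrightarrow>
    finite S \<and> S \<subseteq> carrier G \<and> (\<forall>s\<in>S. inv\<^bsub>G\<^esub> s \<in> S) \<and> generate G S = carrier G"

definition word_length :: "('g, 'x) monoid_scheme \<Rightarrow> 'g set \<Rightarrow> 'g \<Rightarrow> nat"
  where "word_length G S x =
    (LEAST n. \<exists>ss. length ss = n \<and> set ss \<subseteq> S \<and> foldr (\<otimes>\<^bsub>G\<^esub>) ss \<one>\<^bsub>G\<^esub> = x)"

definition word_dist :: "('g, 'x) monoid_scheme \<Rightarrow> 'g set \<Rightarrow> 'g \<Rightarrow> 'g \<Rightarrow> real"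
  where "word_dist G S x y = real (word_length G S (inv\<^bsub>G\<^esub> x \<otimes>\<^bsub>G\<^esub> y))"


section \<open>Controlled coarse homology\<close>

text \<open>A point of \<open>\<Gamma>\<^sup>n\<^sup>+\<^sup>1\<close>, that is, the vertices of an ordered \<open>n\<close>-simplex, is
  a list of length \<open>n + 1\<close>.\<close>

definition simplices :: "('g, 'x) monoid_scheme \<Rightarrow> nat \<Rightarrow> 'g list set"
  where "simplices G n = {xs. length xs = Suc n \<and> set xs \<subseteq> carrier G}"

definition simplex_norm :: "('g, 'x) monoid_scheme \<Rightarrow> 'g set \<Rightarrow> 'g list \<Rightarrow> real"
  where "simplex_norm G S xs = Max ((\<lambda>x. word_dist G S x \<one>\<^bsub>G\<^esub>) ` set xs)"

definition simplex_dist :: "('g, 'x) monoid_scheme \<Rightarrow> 'g set \<Rightarrow> 'g list \<Rightarrow> 'g list \<Rightarrow> real"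
  where "simplex_dist G S xs ys = Max ((\<lambda>i. word_dist G S (xs ! i) (ys ! i)) ` {..<length xs})"

definition dist_to_diagonal :: "('g, 'x) monoid_scheme \<Rightarrow> 'g set \<Rightarrow> 'g list \<Rightarrow> real"
  where "dist_to_diagonal G S xs =
    (INF z\<in>carrier G. simplex_dist G S xs (replicate (length xs) z))"

definition growth_function :: "(real \<Rightarrow> real) \<Rightarrow> bool"
  where "growth_function f \<longleftrightarrow>
    mono_on {0..} f \<and> (\<forall>t\<ge>0. 0 \<le> f t) \<and> f 0 = 1 \<and>
    (\<forall>K>0. \<exists>L>0. \<forall>t>0. f (t + K) \<le> L * f t \<and> f (K * t) \<le> L * f t)"

lemma growth_function_root:
  assumes "0 < d"
  shows "growth_function (\<lambda>t. 1 + t powr (1 / real d))"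
  unfolding growth_function_def
proof (intro conjI allI impI)
  show "mono_on {0..} (\<lambda>t. 1 + t powr (1 / real d))"
    by (auto intro!: mono_onI powr_mono2)
next
  fix K :: real assume K: "0 < K"
  let ?a = "1 / real d"
  have sub: "(t + K) powr ?a \<le> 2 powr ?a * (t powr ?a + K powr ?a)" if "0 < t" for t
  proof -
    have "(t + K) powr ?a \<le> (2 * max t K) powr ?a"
      using that K by (intro powr_mono2) auto
    also have "\<dots> = 2 powr ?a * (max t K) powr ?a"
      using that K by (simp add: powr_mult)
    also have "(max t K) powr ?a \<le> t powr ?a + K powr ?a"
      by (auto simp: max_def)
    finally show ?thesis by (simp add: mult_left_mono)
  qed
  define L where "L = (1 + 2 powr ?a) * (1 + K powr ?a)"
  have L1: "1 \<le> L" "2 powr ?a \<le> L" "1 + 2 powr ?a * K powr ?a \<le> L" "K powr ?a \<le> L"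
    using powr_ge_zero[of 2 ?a] powr_ge_zero[of K ?a]
      mult_nonneg_nonneg[OF powr_ge_zero[of 2 ?a] powr_ge_zero[of K ?a]]
    by (auto simp: L_def distrib_left distrib_right simp del: powr_ge_zero)
  show "\<exists>L>0. \<forall>t>0. 1 + (t + K) powr ?a \<le> L * (1 + t powr ?a) \<and>
      1 + (K * t) powr ?a \<le> L * (1 + t powr ?a)"
  proof (intro exI[of _ L] conjI allI impI)
    show "0 < L" using L1 by linarith
    fix t :: real assume t: "0 < t"
    have "2 powr ?a * t powr ?a \<le> L * t powr ?a" "K powr ?a * t powr ?a \<le> L * t powr ?a"
      using L1 by (auto intro: mult_right_mono)
    moreover have "(K * t) powr ?a = K powr ?a * t powr ?a"
      using K t by (simp add: powr_mult)
    ultimately show "1 + (t + K) powr ?a \<le> L * (1 + t powr ?a)"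
      "1 + (K * t) powr ?a \<le> L * (1 + t powr ?a)"
      using sub[OF t] L1 by (auto simp: distrib_left)
  qed
qed auto

text \<open>Chains are extended by 0 outside \<open>\<Gamma>\<^sup>n\<^sup>+\<^sup>1\<close>, so that equality of chains is equality
  of functions.\<close>

definition chains ::
    "('g, 'x) monoid_scheme \<Rightarrow> 'g set \<Rightarrow> (real \<Rightarrow> real) \<Rightarrow> nat \<Rightarrow> ('g list \<Rightarrow> real) set"
  where "chains G S f n = {c.
    (\<forall>xs. xs \<notin> simplices G n \<longrightarrow> c xs = 0) \<and>
    (\<forall>xs\<in>simplices G n. \<forall>p. p permutes {..<Suc n} \<longrightarrow>
        c (permute_list p xs) = of_int (sign p) * c xs) \<and>
    (\<exists>R. \<forall>xs\<in>simplices G n. R \<le> dist_to_diagonal G S xs \<longrightarrow> c xs = 0) \<and>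
    (\<exists>K. \<forall>xs\<in>simplices G n. \<bar>c xs\<bar> \<le> K * f (simplex_norm G S xs))}"

text \<open>The boundary of an \<open>n\<close>-chain. For \<open>n > 0\<close> finite propagation makes the sum over all \<open>z\<close>
  finite, and the index set below is its support.\<close>

definition boundary ::
    "('g, 'x) monoid_scheme \<Rightarrow> nat \<Rightarrow> ('g list \<Rightarrow> real) \<Rightarrow> 'g list \<Rightarrow> real"
  where "boundary G n c =
    (if n = 0 then (\<lambda>_. 0)
     else (\<lambda>ys. \<Sum>z\<in>{z \<in> carrier G. c (z # ys) \<noteq> 0}. c (z # ys)))"

definition cycle_group ::
    "('g, 'x) monoid_scheme \<Rightarrow> 'g set \<Rightarrow> (real \<Rightarrow> real) \<Rightarrow> nat \<Rightarrow> ('g list \<Rightarrow> real) monoid"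
  where "cycle_group G S f n =
    \<lparr>carrier = {c \<in> chains G S f n. boundary G n c = (\<lambda>_. 0)},
     monoid.mult = (\<lambda>c c' xs. c xs + c' xs),
     one = (\<lambda>_. 0)\<rparr>"

definition boundaries ::
    "('g, 'x) monoid_scheme \<Rightarrow> 'g set \<Rightarrow> (real \<Rightarrow> real) \<Rightarrow> nat \<Rightarrow> ('g list \<Rightarrow> real) set"
  where "boundaries G S f n = boundary G (Suc n) ` chains G S f (Suc n)"

definition coarse_homology_group ::
    "('g, 'x) monoid_scheme \<Rightarrow> 'g set \<Rightarrow> (real \<Rightarrow> real) \<Rightarrow> nat \<Rightarrow> ('g list \<Rightarrow> real) set monoid"
  where "coarse_homology_group G S f n = cycle_group G S f n Mod boundaries G S f n"

definition homology_class ::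
    "('g, 'x) monoid_scheme \<Rightarrow> 'g set \<Rightarrow> (real \<Rightarrow> real) \<Rightarrow> nat \<Rightarrow> ('g list \<Rightarrow> real) \<Rightarrow> ('g list \<Rightarrow> real) set"
  where "homology_class G S f n c = boundaries G S f n #>\<^bsub>cycle_group G S f n\<^esub> c"

text \<open>The chain \<open>\<Sum>\<^bsub>x\<in>\<Gamma>\<^esub> [x]\<close>.\<close>

definition fundamental_chain :: "('g, 'x) monoid_scheme \<Rightarrow> 'g list \<Rightarrow> real"
  where "fundamental_chain G = (\<lambda>xs. if xs \<in> simplices G 0 then 1 else 0)"

definition fundamental_class ::
    "('g, 'x) monoid_scheme \<Rightarrow> 'g set \<Rightarrow> (real \<Rightarrow> real) \<Rightarrow> ('g list \<Rightarrow> real) set"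
  where "fundamental_class G S f = homology_class G S f 0 (fundamental_chain G)"

lemma fundamental_chain_in_cycle_group:
  assumes "group G" and f: "\<And>t. 1 \<le> f t"
  shows "fundamental_chain G \<in> carrier (cycle_group G S f 0)"
proof -
  interpret group G by fact
  have wl: "word_length G S \<one>\<^bsub>G\<^esub> = 0"
    unfolding word_length_def by (rule Least_eq_0) simp
  have *: "dist_to_diagonal G S xs \<le> 0" if "xs \<in> simplices G 0" for xs
  proof -
    from that obtain x where x: "xs = [x]" "x \<in> carrier G"
      by (auto simp: simplices_def length_Suc_conv)
    have "dist_to_diagonal G S xs \<le> simplex_dist G S xs (replicate (length xs) x)"
      unfolding dist_to_diagonal_def
      by (rule cINF_lower[OF _ x(2)])
        (auto intro!: bdd_belowI[of _ 0] simp: simplex_dist_def word_dist_def x(1) lessThan_Suc)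
    also have "\<dots> = 0"
      using x by (simp add: simplex_dist_def word_dist_def wl lessThan_Suc)
    finally show ?thesis .
  qed
  have "\<forall>xs\<in>simplices G 0. 1 \<le> dist_to_diagonal G S xs \<longrightarrow> fundamental_chain G xs = 0"
    using * by (metis not_one_le_zero order_trans)
  moreover have "\<forall>xs\<in>simplices G 0. \<bar>fundamental_chain G xs\<bar> \<le> 1 * f (simplex_norm G S xs)"
    using f by (simp add: fundamental_chain_def)
  moreover have "fundamental_chain G (permute_list p xs) = of_int (sign p) * fundamental_chain G xs"
    if "xs \<in> simplices G 0" "p permutes {..<Suc 0}" for xs p
  proof -
    have "p = id" using that(2) by (simp add: lessThan_Suc)
    then show ?thesis by simp
  qed
  ultimately have "fundamental_chain G \<in> chains G S f 0"
    unfolding chains_def by (intro CollectI conjI) (auto simp: fundamental_chain_def intro: exI[of _ 1])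
  then show ?thesis by (simp add: cycle_group_def boundary_def)
qed

end

theory Submission
  imports Defs
begin

text \<open>
  A bounded-mass flow to infinity is built explicitly. Let \<open>(\<phi>, k)\<close> have \<open>n\<close> lit lamps, and divide
  the \<open>\<int>\<^sup>d\<close>-slice of \<open>\<phi>\<close> into boxes of side \<open>R\<close> proportional to \<open>n\<^sup>1\<^sup>/\<^sup>d\<close> with \<open>R\<^sup>d \<ge> 4n\<close>. Within a box, mass
  is evened out by flows along coordinate lines, whose size is at most a constant times
  \<open>R\<close>; then it leaves the slice by switching on an unlit lamp. A configuration with \<open>n\<close> lit lamps receives
  mass only at its lit sites, which make up at most a quarter of any box, while at least three
  quarters of the sites are available for sending mass on; hence the flow through the switching edges stays
  bounded by 2. The number of lit lamps is at most a constant times the word length,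
  so the total flow is controlled by \<open>1 + t\<^sup>1\<^sup>/\<^sup>d\<close>.
\<close>

section \<open>Vanishing of degree-zero classes\<close>

lemma (in group) foldr_mult_closed:
  "set ss \<subseteq> carrier G \<Longrightarrow> foldr (\<otimes>) ss \<one> \<in> carrier G"
  by (induction ss) auto

lemma (in group) foldr_mult_append:
  assumes "set ss \<subseteq> carrier G" "set ts \<subseteq> carrier G"
  shows "foldr (\<otimes>) (ss @ ts) \<one> = foldr (\<otimes>) ss \<one> \<otimes> foldr (\<otimes>) ts \<one>"
  using assms by (induction ss) (auto simp: m_assoc foldr_mult_closed)

text \<open>Words use letters of \<open>S\<close> only, so the inverses allowed by
  \<open>generate\<close> become letters through the symmetry of \<open>S\<close>; products become
  concatenations. This makes the \<open>LEAST\<close> in \<open>word_length\<close>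
  meaningful.\<close>

lemma (in group) ex_word:
  assumes S: "finite_symmetric_generating_set G S" and x: "x \<in> carrier G"
  shows "\<exists>ss. set ss \<subseteq> S \<and> foldr (\<otimes>) ss \<one> = x"
proof -
  have SG: "S \<subseteq> carrier G" and inv: "\<And>s. s \<in> S \<Longrightarrow> inv s \<in> S"
    using S by (auto simp: finite_symmetric_generating_set_def)
  have "x \<in> generate G S"
    using S x by (simp add: finite_symmetric_generating_set_def)
  then show ?thesis
  proof induction
    case one
    then show ?case by (intro exI[of _ "[]"]) auto
  next
    case (incl s)
    then show ?case using SG by (intro exI[of _ "[s]"]) auto
  next
    case (inv s)
    then show ?case using SG \<open>\<And>s. s \<in> S \<Longrightarrow> inv s \<in> S\<close> by (intro exI[of _ "[inv s]"]) auto
  next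
    case (eng y z)
    then obtain ss ts where "set ss \<subseteq> S" "foldr (\<otimes>) ss \<one> = y" "set ts \<subseteq> S" "foldr (\<otimes>) ts \<one> = z"
      by auto
    then show ?case
      using SG by (intro exI[of _ "ss @ ts"]) (auto simp: foldr_mult_append simp del: foldr_append)
  qed
qed

lemma (in group) word_length_attained:
  assumes "finite_symmetric_generating_set G S" and "x \<in> carrier G"
  shows "\<exists>ss. length ss = word_length G S x \<and> set ss \<subseteq> S \<and> foldr (\<otimes>) ss \<one> = x"
  unfolding word_length_def
  by (rule LeastI_ex[where P = "\<lambda>n. \<exists>ss. length ss = n \<and> set ss \<subseteq> S \<and> foldr (\<otimes>) ss \<one> = x"])
    (use ex_word[OF assms] in blast)

lemma (in group) finite_word_ball:
  assumes S: "finite_symmetric_generating_set G S"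
  shows "finite {x \<in> carrier G. word_length G S x \<le> n}"
proof -
  have "{x \<in> carrier G. word_length G S x \<le> n}
      \<subseteq> (\<lambda>ss. foldr (\<otimes>) ss \<one>) ` {ss. set ss \<subseteq> S \<and> length ss \<le> n}"
    using word_length_attained[OF S] by (fastforce simp: image_iff)
  moreover have "finite {ss. set ss \<subseteq> S \<and> length ss \<le> n}"
    using S by (intro finite_lists_length_le) (simp add: finite_symmetric_generating_set_def)
  ultimately show ?thesis
    by (rule finite_subset[OF _ finite_imageI])
qed

lemma word_dist_nonneg [simp]: "0 \<le> word_dist G S x y"
  by (simp add: word_dist_def)

text \<open>The unevaluated \<open>length [x, y]\<close> matches the term that unfolding
  \<open>dist_to_diagonal_def\<close> produces.\<close>

lemma simplex_dist_pair:
  "simplex_dist G S [x, y] (replicate (length [x, y]) z) = max (word_dist G S x z) (word_dist G S y z)"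
  by (simp add: simplex_dist_def lessThan_Suc numeral_2_eq_2 max.commute)

lemma simplex_norm_pair:
  "simplex_norm G S [x, y] = max (word_dist G S x \<one>\<^bsub>G\<^esub>) (word_dist G S y \<one>\<^bsub>G\<^esub>)"
  by (simp add: simplex_norm_def)

lemma dist_to_diagonal_pair_le:
  assumes "z \<in> carrier G"
  shows "dist_to_diagonal G S [x, y] \<le> max (word_dist G S x z) (word_dist G S y z)"
  unfolding dist_to_diagonal_def simplex_dist_pair
  using assms by (intro cINF_lower bdd_belowI[of _ 0]) (auto simp: le_max_iff_disj)

text \<open>If some \<open>w\<close> is within \<open>R\<close> of both \<open>z\<close> and
  \<open>x\<close>, then \<open>z\<close> is reached from \<open>x\<close> by one element of a ball
  followed by the inverse of another, and balls are finite.\<close>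

lemma (in group) finite_near_diagonal:
  assumes S: "finite_symmetric_generating_set G S" and x: "x \<in> carrier G"
  shows "finite {z \<in> carrier G. dist_to_diagonal G S [z, x] < R}"
proof -
  define B where "B = {b \<in> carrier G. word_length G S b \<le> nat \<lceil>R\<rceil>}"
  have "{z \<in> carrier G. dist_to_diagonal G S [z, x] < R} \<subseteq> (\<lambda>(b, b'). x \<otimes> b \<otimes> inv b') ` (B \<times> B)"
  proof
    fix z assume "z \<in> {z \<in> carrier G. dist_to_diagonal G S [z, x] < R}"
    then have z: "z \<in> carrier G" and lt: "dist_to_diagonal G S [z, x] < R" by auto
    have "\<exists>w\<in>carrier G. max (word_dist G S z w) (word_dist G S x w) < R"
    proof (rule ccontr)
      assume "\<not> ?thesis"
      then have "R \<le> dist_to_diagonal G S [z, x]"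
        unfolding dist_to_diagonal_def simplex_dist_pair
        by (intro cINF_greatest) (use x in \<open>auto simp: not_less\<close>)
      with lt show False by simp
    qed
    then obtain w where w: "w \<in> carrier G" "word_dist G S z w < R" "word_dist G S x w < R"
      by auto
    have "inv z \<otimes> w \<in> B" "inv x \<otimes> w \<in> B"
      using w x z by (auto simp: B_def word_dist_def) linarith+
    moreover have "z = x \<otimes> (inv x \<otimes> w) \<otimes> inv (inv z \<otimes> w)"
    proof -
      have "x \<otimes> (inv x \<otimes> w) = w" using x w by (simp add: m_assoc[symmetric])
      moreover have "w \<otimes> inv (inv z \<otimes> w) = z" using z w by (simp add: inv_mult_group m_assoc[symmetric])
      ultimately show ?thesis by simp
    qed
    ultimately show "z \<in> (\<lambda>(b, b'). x \<otimes> b \<otimes> inv b') ` (B \<times> B)"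
      by (intro image_eqI[of _ _ "(inv x \<otimes> w, inv z \<otimes> w)"]) auto
  qed
  moreover have "finite B"
    unfolding B_def by (rule finite_word_ball[OF S])
  ultimately show ?thesis
    by (meson finite_SigmaI finite_imageI rev_finite_subset)
qed

text \<open>\<open>boundary\<close> sums over the support of its chain, and a sum over an infinite
  set would be 0 by convention. Finite propagation excludes this, so boundaries behave
  additively.\<close>

lemma (in group) finite_boundary_support:
  assumes S: "finite_symmetric_generating_set G S" and c: "c \<in> chains G S f 1"
  shows "finite {z \<in> carrier G. c (z # ys) \<noteq> 0}"
proof (cases "ys \<in> simplices G 0")
  case True
  then obtain x where x: "ys = [x]" "x \<in> carrier G"
    by (auto simp: simplices_def length_Suc_conv)
  obtain R where "\<forall>xs\<in>simplices G 1. R \<le> dist_to_diagonal G S xs \<longrightarrow> c xs = 0"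
    using c unfolding chains_def by blast
  then have "{z \<in> carrier G. c (z # ys) \<noteq> 0} \<subseteq> {z \<in> carrier G. dist_to_diagonal G S [z, x] < R}"
    using x by (force simp: simplices_def not_le[symmetric])
  then show ?thesis
    using finite_near_diagonal[OF S x(2)] finite_subset by blast
next
  case False
  then have "c (z # ys) = 0" if "z \<in> carrier G" for z
    using c that by (auto simp: chains_def simplices_def)
  then have "{z \<in> carrier G. c (z # ys) \<noteq> 0} = {}"
    by blast
  then show ?thesis by (simp only: finite.emptyI)
qed

section \<open>Sums and negatives of chains and boundaries\<close>

lemma chains_add:
  assumes "c \<in> chains G S f n" "c' \<in> chains G S f n"
  shows "(\<lambda>xs. c xs + c' xs) \<in> chains G S f n"
proof -
  obtain R K where c: "\<forall>xs. xs \<notin> simplices G n \<longrightarrow> c xs = 0"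
      "\<forall>xs\<in>simplices G n. \<forall>p. p permutes {..<Suc n} \<longrightarrow> c (permute_list p xs) = of_int (sign p) * c xs"
      "\<forall>xs\<in>simplices G n. R \<le> dist_to_diagonal G S xs \<longrightarrow> c xs = 0"
      "\<forall>xs\<in>simplices G n. \<bar>c xs\<bar> \<le> K * f (simplex_norm G S xs)"
    using assms(1) unfolding chains_def by blast
  obtain R' K' where c': "\<forall>xs. xs \<notin> simplices G n \<longrightarrow> c' xs = 0"
      "\<forall>xs\<in>simplices G n. \<forall>p. p permutes {..<Suc n} \<longrightarrow> c' (permute_list p xs) = of_int (sign p) * c' xs"
      "\<forall>xs\<in>simplices G n. R' \<le> dist_to_diagonal G S xs \<longrightarrow> c' xs = 0"
      "\<forall>xs\<in>simplices G n. \<bar>c' xs\<bar> \<le> K' * f (simplex_norm G S xs)"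
    using assms(2) unfolding chains_def by blast
  show ?thesis
    unfolding chains_def
  proof (intro CollectI conjI)
    show "\<exists>R. \<forall>xs\<in>simplices G n. R \<le> dist_to_diagonal G S xs \<longrightarrow> c xs + c' xs = 0"
      using c(3) c'(3) by (intro exI[of _ "max R R'"]) auto
    have "\<bar>c xs + c' xs\<bar> \<le> (K + K') * f (simplex_norm G S xs)" if "xs \<in> simplices G n" for xs
      using abs_triangle_ineq[of "c xs" "c' xs"] c(4) c'(4) that
      by (fastforce simp: distrib_right)
    then show "\<exists>K. \<forall>xs\<in>simplices G n. \<bar>c xs + c' xs\<bar> \<le> K * f (simplex_norm G S xs)" by blast
  qed (use c(1,2) c'(1,2) in \<open>auto simp: distrib_left\<close>)
qed

lemma chains_uminus:
  assumes "c \<in> chains G S f n"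
  shows "(\<lambda>xs. - c xs) \<in> chains G S f n"
  using assms unfolding chains_def by simp

lemma (in group) boundaries_add:
  assumes S: "finite_symmetric_generating_set G S"
    and "b \<in> boundaries G S f 0" "b' \<in> boundaries G S f 0"
  shows "(\<lambda>xs. b xs + b' xs) \<in> boundaries G S f 0"
proof -
  obtain c c' where c: "c \<in> chains G S f 1" "b = boundary G 1 c"
    and c': "c' \<in> chains G S f 1" "b' = boundary G 1 c'"
    using assms(2,3) by (auto simp: boundaries_def)
  have "boundary G 1 (\<lambda>xs. c xs + c' xs) ys = b ys + b' ys" for ys
  proof -
    \<comment> \<open>The three boundaries are sums over different supports; all are rewritten over
      this common finite set.\<close>
    let ?Z = "{z \<in> carrier G. c (z # ys) \<noteq> 0} \<union> {z \<in> carrier G. c' (z # ys) \<noteq> 0}"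
    have fin: "finite ?Z"
      using finite_boundary_support[OF S] c c' by blast
    have *: "boundary G 1 e ys = (\<Sum>z\<in>?Z. e (z # ys))"
      if "{z \<in> carrier G. e (z # ys) \<noteq> 0} \<subseteq> ?Z" for e
      unfolding boundary_def using that by (auto intro!: sum.mono_neutral_left fin)
    show ?thesis
      unfolding c(2) c'(2) by (subst (1 2 3) *) (auto simp: sum.distrib)
  qed
  then show ?thesis
    unfolding boundaries_def using chains_add[OF c(1) c'(1)] by (auto simp: image_iff fun_eq_iff intro!: bexI)
qed

lemma boundaries_uminus:
  assumes "b \<in> boundaries G S f n"
  shows "(\<lambda>xs. - b xs) \<in> boundaries G S f n"
proof -
  obtain c where c: "c \<in> chains G S f (Suc n)" "b = boundary G (Suc n) c"
    using assms by (auto simp: boundaries_def)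
  have "(\<lambda>xs. - b xs) = boundary G (Suc n) (\<lambda>xs. - c xs)"
    unfolding c(2) by (auto simp: boundary_def sum_negf)
  then show ?thesis
    unfolding boundaries_def using chains_uminus[OF c(1)] by blast
qed

section \<open>Functions on the group that bound, and flows along one group element\<close>

definition zero_chain :: "('g, 'x) monoid_scheme \<Rightarrow> ('g \<Rightarrow> real) \<Rightarrow> 'g list \<Rightarrow> real"
  where "zero_chain G h = (\<lambda>xs. if xs \<in> simplices G 0 then h (hd xs) else 0)"

definition null_homologous ::
    "('g, 'x) monoid_scheme \<Rightarrow> 'g set \<Rightarrow> (real \<Rightarrow> real) \<Rightarrow> ('g \<Rightarrow> real) \<Rightarrow> bool"
  where "null_homologous G S f h \<longleftrightarrow> zero_chain G h \<in> boundaries G S f 0"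

lemma null_homologous_cong:
  assumes "null_homologous G S f h" and "\<And>x. x \<in> carrier G \<Longrightarrow> h' x = h x"
  shows "null_homologous G S f h'"
proof -
  have "zero_chain G h' = zero_chain G h"
    using assms(2) by (fastforce simp: zero_chain_def simplices_def length_Suc_conv)
  with assms(1) show ?thesis by (simp add: null_homologous_def)
qed

lemma (in group) null_homologous_add:
  assumes "finite_symmetric_generating_set G S"
    and "null_homologous G S f h" "null_homologous G S f h'"
  shows "null_homologous G S f (\<lambda>x. h x + h' x)"
proof -
  have "zero_chain G (\<lambda>x. h x + h' x) = (\<lambda>xs. zero_chain G h xs + zero_chain G h' xs)"
    by (auto simp: zero_chain_def)
  then show ?thesis
    using boundaries_add assms unfolding null_homologous_def by metis
qed

text \<open>Read \<open>u x\<close> as the mass sent along the edge from \<open>x\<close> to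
  \<open>x \<otimes> s\<close>. The stated function is outflow minus inflow at \<open>x\<close>,
  which is the boundary of this flow viewed as a 1-chain. Here \<open>s\<close> may be any group
  element, since edges of bounded length suffice for finite propagation.\<close>

lemma (in group) null_homologous_translate:
  assumes s: "s \<in> carrier G"
    and f: "mono_on {0..} f" "0 \<le> K" and u: "\<And>x. x \<in> carrier G \<Longrightarrow> \<bar>u x\<bar> \<le> K * f (word_dist G S x \<one>)"
  shows "null_homologous G S f (\<lambda>x. u x - u (x \<otimes> inv s))"
proof -
  \<comment> \<open>The flow is antisymmetrized. Since \<open>boundary\<close> sums over the first
    vertex, the positive sign goes to the mass that the second vertex sends to the first.\<close>
  define e where "e x y = (if x = y \<otimes> s then u y else 0) - (if y = x \<otimes> s then u x else 0)" for x y
  define c where "c xs = (if xs \<in> simplices G 1 then e (xs ! 0) (xs ! 1) else 0)" for xs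
  have pair: "\<exists>x\<in>carrier G. \<exists>y\<in>carrier G. xs = [x, y]" if "xs \<in> simplices G 1" for xs
    using that by (auto simp: simplices_def length_Suc_conv)
  have c_pair: "c [x, y] = e x y" if "x \<in> carrier G" "y \<in> carrier G" for x y
    using that by (simp add: c_def simplices_def)
  have e_commute: "e y x = - e x y" for x y
    by (simp add: e_def)
  have "c \<in> chains G S f 1"
    unfolding chains_def
  proof (intro CollectI conjI)
    show "\<forall>xs. xs \<notin> simplices G 1 \<longrightarrow> c xs = 0"
      by (simp add: c_def)
    show "\<forall>xs\<in>simplices G 1. \<forall>p. p permutes {..<Suc 1} \<longrightarrow>
        c (permute_list p xs) = of_int (sign p) * c xs"
    proof (intro ballI allI impI)
      fix xs p assume xs: "xs \<in> simplices G 1" and "p permutes {..<Suc 1}"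
      then have p: "p = id \<or> p = Transposition.transpose 0 1"
        by (simp add: lessThan_Suc insert_commute permutes_doubleton_iff)
      obtain x y where xy: "xs = [x, y]" "x \<in> carrier G" "y \<in> carrier G"
        using pair[OF xs] by blast
      have "permute_list (Transposition.transpose 0 1) [x, y] = [y, x]"
        by (simp add: permute_list_def)
      then show "c (permute_list p xs) = of_int (sign p) * c xs"
        using p xy e_commute[of x y] by (auto simp: c_pair sign_swap_id)
    qed
    show "\<exists>R. \<forall>xs\<in>simplices G 1. R \<le> dist_to_diagonal G S xs \<longrightarrow> c xs = 0"
    proof (intro exI ballI impI)
      fix xs
      \<comment> \<open>Comparison with the diagonal point \<open>y\<close> involves the distance
        from \<open>x\<close> to \<open>y\<close>, which on an edge is the length of
        \<open>s\<close> or \<open>inv s\<close>, and the distance from \<open>y\<close> to itself,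
        the length of \<open>\<one>\<close>. The final 1 makes the inequality strict.\<close>
      let ?R = "real (word_length G S s) + real (word_length G S (inv s)) + real (word_length G S \<one>) + 1"
      assume "xs \<in> simplices G 1" and R: "?R \<le> dist_to_diagonal G S xs"
      then obtain x y where xy: "xs = [x, y]" "x \<in> carrier G" "y \<in> carrier G"
        using pair by blast
      have far: "?R \<le> max (word_dist G S x y) (word_length G S \<one>)"
        using R dist_to_diagonal_pair_le[of y G S x y] xy by (simp add: word_dist_def)
      have "y \<noteq> x \<otimes> s"
      proof
        assume "y = x \<otimes> s"
        then have "inv x \<otimes> y = s" using xy s by (simp add: m_assoc[symmetric])
        then show False using far by (simp add: word_dist_def max_def split: if_splits)
      qed
      moreover have "x \<noteq> y \<otimes> s"
      proof
        assume "x = y \<otimes> s"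
        then have "inv x \<otimes> y = inv s" using xy s by (simp add: inv_mult_group m_assoc)
        then show False using far by (simp add: word_dist_def max_def split: if_splits)
      qed
      ultimately show "c xs = 0"
        using xy by (simp add: c_pair e_def)
    qed
    \<comment> \<open>The factor 2 covers both terms of \<open>e\<close>, which occur together when
      \<open>s\<close> is its own inverse.\<close>
    have "\<bar>c xs\<bar> \<le> (2 * K) * f (simplex_norm G S xs)" if "xs \<in> simplices G 1" for xs
    proof -
      from pair[OF that] obtain x y where xy: "xs = [x, y]" "x \<in> carrier G" "y \<in> carrier G"
        by blast
      have "\<bar>u z\<bar> \<le> K * f (simplex_norm G S xs)" if "z \<in> {x, y}" for z
      proof -
        have "K * f (word_dist G S z \<one>) \<le> K * f (simplex_norm G S xs)"
          using that by (intro mult_left_mono f(2) mono_onD[OF f(1)]) (auto simp: xy(1) simplex_norm_pair le_max_iff_disj)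
        moreover have "z \<in> carrier G" using that xy by auto
        ultimately show ?thesis
          using u[of z] by linarith
      qed
      from this[of x] this[of y] show ?thesis
        using xy by (auto simp: c_pair e_def)
    qed
    then show "\<exists>K. \<forall>xs\<in>simplices G 1. \<bar>c xs\<bar> \<le> K * f (simplex_norm G S xs)" by blast
  qed
  moreover have "boundary G 1 c ys = zero_chain G (\<lambda>x. u x - u (x \<otimes> inv s)) ys" for ys
  proof (cases "ys \<in> simplices G 0")
    case True
    then obtain x where x: "ys = [x]" "x \<in> carrier G"
      by (auto simp: simplices_def length_Suc_conv)
    have eq: "x = z \<otimes> s \<longleftrightarrow> z = x \<otimes> inv s" if "z \<in> carrier G" for z
      using that x s by (metis inv_closed inv_solve_right)
    have "boundary G 1 c ys = (\<Sum>z\<in>{x \<otimes> s, x \<otimes> inv s}. c (z # ys))"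
      unfolding boundary_def if_not_P[OF one_neq_zero]
    proof (rule sum.mono_neutral_left)
      show "{z \<in> carrier G. c (z # ys) \<noteq> 0} \<subseteq> {x \<otimes> s, x \<otimes> inv s}"
        using x by (auto simp: c_pair e_def eq split: if_splits)
    qed (use x s in auto)
    \<comment> \<open>The two neighbours may coincide, so outflow and inflow are separated by
      indicators instead of listing the set.\<close>
    also have "\<dots> = (\<Sum>z\<in>{x \<otimes> s, x \<otimes> inv s}. if z = x \<otimes> s then u x else 0)
        - (\<Sum>z\<in>{x \<otimes> s, x \<otimes> inv s}. if z = x \<otimes> inv s then u (x \<otimes> inv s) else 0)"
      unfolding sum_subtractf[symmetric] using x s by (intro sum.cong) (auto simp: c_pair e_def eq)
    also have "\<dots> = u x - u (x \<otimes> inv s)"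
      by (simp only: sum.delta finite.intros) auto
    finally show ?thesis
      using x True by (simp add: zero_chain_def)
  next
    case False
    then have "z # ys \<notin> simplices G 1" for z
      by (auto simp: simplices_def)
    then show ?thesis
      using False by (simp add: boundary_def c_def zero_chain_def)
  qed
  then have "zero_chain G (\<lambda>x. u x - u (x \<otimes> inv s)) = boundary G (Suc 0) c"
    by (simp add: fun_eq_iff)
  ultimately show ?thesis
    by (auto simp: null_homologous_def boundaries_def)
qed

text \<open>The identity of the quotient is the set of boundaries itself. Translating this set by
  one of its own members gives it back, by closure under sums and negatives.\<close>

lemma (in group) fundamental_class_eq_one:
  assumes S: "finite_symmetric_generating_set G S"
    and null: "null_homologous G S f (\<lambda>_. 1)"
  shows "fundamental_class G S f = \<one>\<^bsub>coarse_homology_group G S f 0\<^esub>"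
proof -
  have fc: "fundamental_chain G \<in> boundaries G S f 0"
    using null by (simp add: null_homologous_def zero_chain_def fundamental_chain_def)
  have "b \<in> (\<lambda>b xs. b xs + fundamental_chain G xs) ` boundaries G S f 0"
    if "b \<in> boundaries G S f 0" for b
    using boundaries_add[OF S that boundaries_uminus[OF fc]]
    by (intro image_eqI[of _ _ "\<lambda>xs. b xs + - fundamental_chain G xs"]) auto
  then show ?thesis
    using boundaries_add[OF S _ fc]
    by (auto simp: fundamental_class_def homology_class_def r_coset_def cycle_group_def
        coarse_homology_group_def FactGroup_def image_iff)
qed


section \<open>Averages over boxes\<close>

definition block :: "int \<Rightarrow> int \<Rightarrow> int set"
  where "block R t = {R * (t div R)..<R * (t div R) + R}"

lemma mem_block_iff:
  assumes R: "0 < R"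
  shows "s \<in> block R t \<longleftrightarrow> s div R = t div R"
proof
  assume "s \<in> block R t"
  then show "s div R = t div R"
    unfolding block_def by (intro int_div_pos_eq[of _ _ _ "s - R * (t div R)"]) auto
next
  assume "s div R = t div R"
  then have "s = R * (t div R) + s mod R"
    using mult_div_mod_eq[of R s] by simp
  moreover have "0 \<le> s mod R" "s mod R < R" using R by simp_all
  ultimately show "s \<in> block R t"
    unfolding block_def atLeastLessThan_iff by linarith
qed

lemma block_eq: "0 < R \<Longrightarrow> s \<in> block R t \<Longrightarrow> block R s = block R t"
  by (simp add: mem_block_iff) (simp add: block_def)

lemma self_mem_block: "0 < R \<Longrightarrow> t \<in> block R t"
  by (simp add: mem_block_iff)

lemma finite_block [simp]: "finite (block R t)"
  by (simp add: block_def)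

lemma card_block [simp]: "card (block R t) = nat R"
  by (simp add: block_def)

text \<open>A discrete antiderivative of \<open>q\<close> minus its block mean, restarted at the
  left end of each block. It is the mass passed from \<open>t\<close> to \<open>t + 1\<close> when
  \<open>q\<close> is evened out within blocks.\<close>

definition block_flow :: "int \<Rightarrow> (int \<Rightarrow> real) \<Rightarrow> int \<Rightarrow> real"
  where "block_flow R q t = (\<Sum>s\<in>{R * (t div R)..t}. q s - sum q (block R t) / R)"

text \<open>Inside a block the partial sums telescope. At a left end, the flow at
  \<open>t - 1\<close> is the sum of all deviations from the mean over the preceding block, hence 0:
  nothing crosses between blocks.\<close>

lemma block_flow_diff:
  assumes R: "0 < R"
  shows "block_flow R q t - block_flow R q (t - 1) = q t - sum q (block R t) / R"
proof (cases "t = R * (t div R)")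
  case True
  have eq: "(t - 1) div R = t div R - 1"
  proof -
    have "(R * (t div R) - 1) div R = t div R - 1"
      using R by (intro int_div_pos_eq[of _ _ _ "R - 1"]) (auto simp: algebra_simps)
    then show ?thesis using True by simp
  qed
  have "t = R * ((t - 1) div R) + R"
    using True unfolding eq right_diff_distrib by linarith
  then have "{R * ((t - 1) div R)..t - 1} = block R (t - 1)"
    unfolding block_def by auto
  then have "block_flow R q (t - 1) = 0"
    using R by (simp add: block_flow_def sum_subtractf)
  moreover have "{R * (t div R)..t} = {t}" using True by auto
  ultimately show ?thesis by (simp add: block_flow_def)
next
  case False
  then have less: "R * (t div R) < t"
    using R pos_mod_sign[of R t] mult_div_mod_eq[of R t] by linarith
  have "t - 1 \<in> block R t"
    using less self_mem_block[OF R, of t] by (auto simp: block_def)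
  then have eq: "(t - 1) div R = t div R" "block R (t - 1) = block R t"
    using R mem_block_iff block_eq by blast+
  have "{R * (t div R)..t} = insert t {R * (t div R)..t - 1}"
    using less by auto
  then show ?thesis
    by (simp add: block_flow_def eq)
qed

lemma abs_block_average_le:
  assumes R: "0 < R" and q: "\<And>s. s \<in> block R t \<Longrightarrow> \<bar>q s\<bar> \<le> M"
  shows "\<bar>sum q (block R t) / R\<bar> \<le> M"
proof -
  have "\<bar>sum q (block R t)\<bar> \<le> (\<Sum>s\<in>block R t. M)"
    using q by (intro order_trans[OF sum_abs] sum_mono)
  then show ?thesis
    using R by (simp add: divide_simps mult.commute)
qed

text \<open>There are at most \<open>R\<close> summands, each a difference of two numbers bounded by
  \<open>M\<close>. This factor \<open>R\<close> is the only unbounded contribution to the final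
  flow.\<close>

lemma abs_block_flow_le:
  assumes R: "0 < R" and q: "\<And>s. \<bar>q s\<bar> \<le> M"
  shows "\<bar>block_flow R q t\<bar> \<le> R * (2 * M)"
proof -
  have M: "0 \<le> M" using q[of 0] by linarith
  have "\<bar>q s - sum q (block R t) / R\<bar> \<le> 2 * M" for s
    using q[of s] abs_block_average_le[of R t q M, OF R q] by linarith
  then have "\<bar>block_flow R q t\<bar> \<le> (\<Sum>s\<in>{R * (t div R)..t}. 2 * M)"
    unfolding block_flow_def by (intro order_trans[OF sum_abs] sum_mono)
  also have "\<dots> \<le> (\<Sum>s\<in>block R t. 2 * M)"
    using M self_mem_block[OF R, of t] by (intro sum_mono2) (auto simp: block_def)
  also have "\<dots> = R * (2 * M)"
    using R by simp
  finally show ?thesis .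
qed

section \<open>Boxes built up one coordinate at a time, and their averages\<close>

text \<open>The parameter \<open>m\<close> interpolates between the single site \<open>k\<close> at
  \<open>m = 0\<close> and the full box at \<open>m = d\<close>, so that averaging can proceed by
  induction on coordinates.\<close>

definition cell :: "nat \<Rightarrow> nat \<Rightarrow> int \<Rightarrow> (nat \<Rightarrow> int) \<Rightarrow> (nat \<Rightarrow> int) set"
  where "cell d m R k = PiE {..<d} (\<lambda>i. if i < m then block R (k i) else {k i})"

lemma mem_cellD:
  "l \<in> cell d m R k \<Longrightarrow> i < d \<Longrightarrow> l i \<in> (if i < m then block R (k i) else {k i})"
  by (simp add: cell_def PiE_iff)

lemma cell_subset: "cell d m R k \<subseteq> {..<d} \<rightarrow>\<^sub>E UNIV"
  unfolding cell_def by (rule PiE_mono) simp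

lemma finite_cell [simp]: "finite (cell d m R k)"
  by (auto simp: cell_def intro!: finite_PiE)

lemma cell_0: "k \<in> {..<d} \<rightarrow>\<^sub>E UNIV \<Longrightarrow> cell d 0 R k = {k}"
  by (simp add: cell_def PiE_iff PiE_singleton)

lemma card_full_cell: "card (cell d d R k) = nat R ^ d"
  by (simp add: cell_def card_PiE)

lemma full_cell_eq:
  assumes "0 < R" "l \<in> cell d d R k"
  shows "cell d d R l = cell d d R k"
  unfolding cell_def
proof (rule PiE_cong)
  fix i assume "i \<in> {..<d}"
  then show "(if i < d then block R (l i) else {l i}) = (if i < d then block R (k i) else {k i})"
    using mem_cellD[OF assms(2), of i] block_eq[OF assms(1)] by simp
qed

lemma cell_Suc:
  assumes "m < d" "0 < R"
  shows "cell d (Suc m) R k = (\<Union>t\<in>block R (k m). cell d m R (k(m := t)))"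
proof (intro equalityI subsetI)
  fix l assume l: "l \<in> cell d (Suc m) R k"
  have "l i \<in> (if i < m then block R ((k(m := l m)) i) else {(k(m := l m)) i})" if "i < d" for i
    using mem_cellD[OF l that] by (cases i m rule: linorder_cases) simp_all
  then have "l \<in> cell d m R (k(m := l m))"
    using l by (simp add: cell_def PiE_iff)
  moreover have "l m \<in> block R (k m)"
    using mem_cellD[OF l assms(1)] by simp
  ultimately show "l \<in> (\<Union>t\<in>block R (k m). cell d m R (k(m := t)))" by blast
next
  fix l assume "l \<in> (\<Union>t\<in>block R (k m). cell d m R (k(m := t)))"
  then obtain t where t: "t \<in> block R (k m)" and l: "l \<in> cell d m R (k(m := t))" by blast
  have "l i \<in> (if i < Suc m then block R (k i) else {k i})" if "i < d" for i
    using mem_cellD[OF l that] t by (cases i m rule: linorder_cases) simp_all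
  then show "l \<in> cell d (Suc m) R k"
    using l by (simp add: cell_def PiE_iff)
qed

definition average :: "nat \<Rightarrow> nat \<Rightarrow> int \<Rightarrow> ((nat \<Rightarrow> int) \<Rightarrow> real) \<Rightarrow> (nat \<Rightarrow> int) \<Rightarrow> real"
  where "average d m R q k = sum q (cell d m R k) / R ^ m"

lemma average_0: "k \<in> {..<d} \<rightarrow>\<^sub>E UNIV \<Longrightarrow> average d 0 R q k = q k"
  by (simp add: average_def cell_0)

text \<open>One more coordinate is averaged by taking the block mean, along that coordinate, of the
  averages already formed. This reduces levelling on boxes to \<open>block_flow\<close>.\<close>

lemma average_Suc:
  assumes m: "m < d" and R: "0 < R"
  shows "average d (Suc m) R q k = (\<Sum>t\<in>block R (k m). average d m R q (k(m := t))) / R"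
proof -
  \<comment> \<open>Coordinate \<open>m\<close> identifies the slice, so the slices in
    \<open>cell_Suc\<close> are disjoint.\<close>
  have "l m = t" if "l \<in> cell d m R (k(m := t))" for l t
    using mem_cellD[OF that m] by simp
  then have "sum q (cell d (Suc m) R k) = (\<Sum>t\<in>block R (k m). sum q (cell d m R (k(m := t))))"
    unfolding cell_Suc[OF m R] by (intro sum.UNION_disjoint) (simp_all add: disjoint_iff, metis)
  then show ?thesis
    by (simp add: average_def sum_divide_distrib[symmetric] field_simps)
qed

lemma PiE_UNIV_fun_upd: "k \<in> {..<d} \<rightarrow>\<^sub>E UNIV \<Longrightarrow> m < d \<Longrightarrow> k(m := t) \<in> {..<d} \<rightarrow>\<^sub>E UNIV"
  by (auto simp: PiE_iff extensional_def)

lemma abs_average_le: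
  assumes R: "0 < R" and q: "\<And>k. k \<in> {..<d} \<rightarrow>\<^sub>E UNIV \<Longrightarrow> \<bar>q k\<bar> \<le> M"
    and "m \<le> d" "k \<in> {..<d} \<rightarrow>\<^sub>E UNIV"
  shows "\<bar>average d m R q k\<bar> \<le> M"
  using assms(3,4)
proof (induction m arbitrary: k)
  case 0
  then show ?case using q by (simp add: average_0)
next
  case (Suc m)
  then show ?case
    using PiE_UNIV_fun_upd[OF Suc.prems(2), of m] R
    by (subst average_Suc) (auto intro!: abs_block_average_le simp del: abs_divide)
qed

text \<open>The factor 4 makes \<open>n\<close> sites at most a quarter of a box; the added 1 keeps
  the side positive when \<open>n = 0\<close>.\<close>

definition side :: "nat \<Rightarrow> nat \<Rightarrow> int"
  where "side d n = \<lceil>(4 * real n) powr (1 / real d)\<rceil> + 1"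

lemma side_pos [simp]: "0 < side d n"
proof -
  have "(0::real) \<le> (4 * real n) powr (1 / real d)" by simp
  then show ?thesis unfolding side_def by linarith
qed

lemma side_power_ge:
  assumes "0 < d"
  shows "4 * n \<le> nat (side d n) ^ d"
proof -
  have "real (4 * n) = ((4 * real n) powr (1 / real d)) ^ d"
    using assms by (cases "n = 0") (simp_all add: powr_realpow[symmetric] powr_powr power_0_left)
  also have "\<dots> \<le> of_int (side d n) ^ d"
  proof (rule power_mono)
    show "(4 * real n) powr (1 / real d) \<le> of_int (side d n)"
      unfolding side_def by linarith
  qed simp
  also have "\<dots> = real (nat (side d n) ^ d)"
    by (simp add: order_less_imp_le)
  finally show ?thesis
    by (simp only: of_nat_le_iff)
qed

lemma side_le: "side d n \<le> 2 + (4 * real n) powr (1 / real d)"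
  unfolding side_def by linarith


section \<open>Flows on lamplighter groups\<close>

text \<open>The element \<open>g\<close> is the one lit state used by the flow: mass changes slices
  only by switching a lamp from \<open>\<one>\<close> to \<open>g\<close>.\<close>

locale lamplighter =
  fixes F :: "('a, 'b) monoid_scheme" and d :: nat
    and S :: "(((nat \<Rightarrow> int) \<Rightarrow> 'a) \<times> (nat \<Rightarrow> int)) set" and g :: 'a
  assumes group_F: "group F" and g: "g \<in> carrier F" "g \<noteq> \<one>\<^bsub>F\<^esub>"
    and d: "0 < d"
    and S: "finite_symmetric_generating_set (wreath_product F (int_power_group d)) S"
begin

sublocale F: group F
  by (rule group_F)

section \<open>The wreath product in coordinates, and lit lamps against word length\<close>

abbreviation "sites \<equiv> {..<d} \<rightarrow>\<^sub>E (UNIV :: int set)"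

abbreviation "\<Gamma> \<equiv> wreath_product F (int_power_group d)"

abbreviation "f \<equiv> (\<lambda>t::real. 1 + t powr (1 / real d))"

sublocale H: group "int_power_group d"
  by (rule group_int_power_group)

sublocale W: group \<Gamma>
  by (rule group_wreath_product[OF group_F group_int_power_group])

definition supp :: "((nat \<Rightarrow> int) \<Rightarrow> 'a) \<Rightarrow> (nat \<Rightarrow> int) set"
  where "supp \<phi> = {k \<in> sites. \<phi> k \<noteq> \<one>\<^bsub>F\<^esub>}"

definition lamps :: "((nat \<Rightarrow> int) \<Rightarrow> 'a) set"
  where "lamps = {\<phi> \<in> sites \<rightarrow>\<^sub>E carrier F. finite (supp \<phi>)}"

lemma carrier_sites: "carrier (int_power_group d) = sites"
  by (simp add: int_power_group_def)

lemma carrier_\<Gamma>: "carrier \<Gamma> = lamps \<times> sites"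
  unfolding wreath_product_def semidirect_product_def lamps_def supp_def
  by (simp add: carrier_sites carrier_sum_group group_F)

lemma mult_\<Gamma>:
  "(\<phi>, k) \<otimes>\<^bsub>\<Gamma>\<^esub> (\<psi>, l) =
    (\<lambda>x\<in>sites. \<phi> x \<otimes>\<^bsub>F\<^esub> \<psi> (inv\<^bsub>int_power_group d\<^esub> k \<otimes>\<^bsub>int_power_group d\<^esub> x), k \<otimes>\<^bsub>int_power_group d\<^esub> l)"
  unfolding wreath_product_def semidirect_product_def translation_action_def
  by (auto simp: carrier_sites)

lemma one_\<Gamma>: "\<one>\<^bsub>\<Gamma>\<^esub> = (\<lambda>x\<in>sites. \<one>\<^bsub>F\<^esub>, \<lambda>i\<in>{..<d}. 0)"
  unfolding wreath_product_def semidirect_product_def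
  by (simp add: carrier_sites) (simp add: int_power_group_def)

text \<open>A lamp lit in the product is lit in the first factor or lies in the translate, by the
  position of the first factor, of the support of the second.\<close>

lemma card_supp_mult_le:
  assumes x: "x \<in> carrier \<Gamma>" and y: "y \<in> carrier \<Gamma>"
  shows "card (supp (fst (x \<otimes>\<^bsub>\<Gamma>\<^esub> y))) \<le> card (supp (fst x)) + card (supp (fst y))"
proof -
  obtain \<phi> k \<psi> l where xy: "x = (\<phi>, k)" "y = (\<psi>, l)" by (cases x, cases y)
  have mem: "\<phi> \<in> lamps" "k \<in> sites" "\<psi> \<in> lamps" "l \<in> sites"
    using x y by (auto simp: xy carrier_\<Gamma>)
  have "supp (fst (x \<otimes>\<^bsub>\<Gamma>\<^esub> y)) \<subseteq> supp \<phi> \<union> (\<lambda>z. k \<otimes>\<^bsub>int_power_group d\<^esub> z) ` supp \<psi>"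
  proof
    fix z assume z: "z \<in> supp (fst (x \<otimes>\<^bsub>\<Gamma>\<^esub> y))"
    let ?z = "inv\<^bsub>int_power_group d\<^esub> k \<otimes>\<^bsub>int_power_group d\<^esub> z"
    have zs: "z \<in> sites" using z by (simp add: supp_def)
    have z': "?z \<in> sites" "k \<otimes>\<^bsub>int_power_group d\<^esub> ?z = z"
      using mem(2) zs by (auto simp: carrier_sites[symmetric] H.m_assoc[symmetric])
    show "z \<in> supp \<phi> \<union> (\<lambda>z. k \<otimes>\<^bsub>int_power_group d\<^esub> z) ` supp \<psi>"
    proof (cases "\<phi> z = \<one>\<^bsub>F\<^esub>")
      case True
      have "\<psi> ?z \<noteq> \<one>\<^bsub>F\<^esub>"
      proof
        assume "\<psi> ?z = \<one>\<^bsub>F\<^esub>"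
        then have "fst (x \<otimes>\<^bsub>\<Gamma>\<^esub> y) z = \<one>\<^bsub>F\<^esub>"
          unfolding xy mult_\<Gamma> fst_conv restrict_apply'[OF zs] True by simp
        then show False using z unfolding supp_def by blast
      qed
      then have "?z \<in> supp \<psi>" unfolding supp_def using z'(1) by blast
      then show ?thesis by (intro UnI2 image_eqI[where x = ?z] z'(2)[symmetric])
    next
      case False
      then show ?thesis using zs by (simp add: supp_def)
    qed
  qed
  moreover have "finite (supp \<phi>)" "finite (supp \<psi>)"
    using mem by (auto simp: lamps_def)
  ultimately have "card (supp (fst (x \<otimes>\<^bsub>\<Gamma>\<^esub> y))) \<le> card (supp \<phi> \<union> (\<lambda>z. k \<otimes>\<^bsub>int_power_group d\<^esub> z) ` supp \<psi>)"
    by (intro card_mono finite_UnI finite_imageI)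
  also have "\<dots> \<le> card (supp \<phi>) + card (supp \<psi>)"
    using \<open>finite (supp \<psi>)\<close> by (intro order_trans[OF card_Un_le] add_left_mono card_image_le)
  finally show ?thesis by (simp add: xy)
qed

lemma card_supp_le_word_dist:
  "\<exists>C::nat. \<forall>x\<in>carrier \<Gamma>. card (supp (fst x)) \<le> C * word_dist \<Gamma> S x \<one>\<^bsub>\<Gamma>\<^esub>"
proof -
  \<comment> \<open>By definition \<open>word_dist\<close> from \<open>x\<close> to the identity is
    the word length of the inverse of \<open>x\<close>, so lamps are counted after
    inversion.\<close>
  define n where "n x = card (supp (fst (inv\<^bsub>\<Gamma>\<^esub> x)))" for x
  define C where "C = sum n S"
  have SG: "S \<subseteq> carrier \<Gamma>" and fin: "finite S"
    using S by (auto simp: finite_symmetric_generating_set_def)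
  have words: "n (foldr (\<otimes>\<^bsub>\<Gamma>\<^esub>) ss \<one>\<^bsub>\<Gamma>\<^esub>) \<le> C * length ss" if "set ss \<subseteq> S" for ss
    using that
  proof (induction ss)
    case Nil
    have "supp (\<lambda>x\<in>sites. \<one>\<^bsub>F\<^esub>) = {}" by (auto simp: supp_def)
    then have "n \<one>\<^bsub>\<Gamma>\<^esub> = 0"
      unfolding n_def W.inv_one by (simp add: one_\<Gamma>)
    then show ?case by simp
  next
    case (Cons s ss)
    let ?w = "foldr (\<otimes>\<^bsub>\<Gamma>\<^esub>) ss \<one>\<^bsub>\<Gamma>\<^esub>"
    have mem: "s \<in> carrier \<Gamma>" "?w \<in> carrier \<Gamma>" "s \<in> S"
      using Cons.prems SG by (auto intro!: W.foldr_mult_closed)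
    have "n (s \<otimes>\<^bsub>\<Gamma>\<^esub> ?w) \<le> n ?w + n s"
      using mem unfolding n_def by (simp add: W.inv_mult_group card_supp_mult_le)
    moreover have "n s \<le> C"
      unfolding C_def using mem fin by (intro member_le_sum) auto
    moreover have "n ?w \<le> C * length ss"
      using Cons by simp
    ultimately show ?case by simp
  qed
  have "card (supp (fst x)) \<le> C * word_dist \<Gamma> S x \<one>\<^bsub>\<Gamma>\<^esub>" if x: "x \<in> carrier \<Gamma>" for x
  proof -
    have ix: "inv\<^bsub>\<Gamma>\<^esub> x \<in> carrier \<Gamma>" using x by simp
    obtain ss where ss: "length ss = word_length \<Gamma> S (inv\<^bsub>\<Gamma>\<^esub> x)" "set ss \<subseteq> S"
        "foldr (\<otimes>\<^bsub>\<Gamma>\<^esub>) ss \<one>\<^bsub>\<Gamma>\<^esub> = inv\<^bsub>\<Gamma>\<^esub> x"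
      using W.word_length_attained[OF S ix] by blast
    have "card (supp (fst x)) \<le> C * word_length \<Gamma> S (inv\<^bsub>\<Gamma>\<^esub> x)"
      using words[OF ss(2)] x unfolding ss(1,3) by (simp add: n_def)
    then show ?thesis
      using x by (simp add: word_dist_def flip: of_nat_mult)
  qed
  then show ?thesis by blast
qed

text \<open>The exponent \<open>1 / d\<close> enters here: the side grows like the
  \<open>d\<close>-th root of the number of lit lamps, which is at most linear in the word
  length.\<close>

lemma side_le_growth:
  "\<exists>K\<ge>0. \<forall>x\<in>carrier \<Gamma>. side d (card (supp (fst x))) \<le> K * f (word_dist \<Gamma> S x \<one>\<^bsub>\<Gamma>\<^esub>)"
proof -
  obtain C :: nat where C: "\<And>x. x \<in> carrier \<Gamma> \<Longrightarrow> card (supp (fst x)) \<le> C * word_dist \<Gamma> S x \<one>\<^bsub>\<Gamma>\<^esub>"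
    using card_supp_le_word_dist by blast
  define K where "K = (4 * real C) powr (1 / real d)"
  have "side d (card (supp (fst x))) \<le> (2 + K) * f (word_dist \<Gamma> S x \<one>\<^bsub>\<Gamma>\<^esub>)" if x: "x \<in> carrier \<Gamma>" for x
  proof -
    let ?w = "word_dist \<Gamma> S x \<one>\<^bsub>\<Gamma>\<^esub>"
    have "(4 * real (card (supp (fst x)))) powr (1 / real d) \<le> (4 * real C * ?w) powr (1 / real d)"
      using C[OF x] by (intro powr_mono2) auto
    also have "\<dots> = K * ?w powr (1 / real d)"
      unfolding K_def by (intro powr_mult) 
    finally have "real_of_int (side d (card (supp (fst x)))) \<le> 2 + K * ?w powr (1 / real d)"
      using side_le[of d "card (supp (fst x))"] by linarith
    also have "\<dots> \<le> (2 + K) * f ?w"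
      by (simp add: distrib_left distrib_right K_def)
    finally show ?thesis .
  qed
  moreover have "0 \<le> 2 + K" by (simp add: K_def)
  ultimately show ?thesis by blast
qed

lemma mono_f: "mono_on {0..} f"
  by (auto intro!: mono_onI powr_mono2)

lemma one_le_side: "1 \<le> real_of_int (side d n)"
  using side_pos[of d n] by linarith

lemma lamps_closed [simp]: "\<phi> \<in> lamps \<Longrightarrow> k \<in> sites \<Longrightarrow> \<phi> k \<in> carrier F"
  unfolding lamps_def by blast

lemma restrict_lamps: "\<phi> \<in> lamps \<Longrightarrow> restrict \<phi> sites = \<phi>"
  unfolding lamps_def by (blast intro: PiE_restrict)

section \<open>Elementary flows: changing the position and switching a lamp\<close>

text \<open>The source \<open>t x\<close> of the edge into \<open>x\<close> is characterized by
  multiplication with \<open>s\<close>, so that inverses in the wreath product need not be computed.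
  The bound on \<open>u\<close> is stated through \<open>side\<close>, as the levelling flows
  provide it.\<close>

lemma null_homologous_step:
  fixes u :: "((nat \<Rightarrow> int) \<Rightarrow> 'a) \<times> (nat \<Rightarrow> int) \<Rightarrow> real" and M :: real
  assumes s: "s \<in> carrier \<Gamma>" "0 \<le> M"
    and u: "\<And>x. x \<in> carrier \<Gamma> \<Longrightarrow> \<bar>u x\<bar> \<le> M * side d (card (supp (fst x)))"
    and t: "\<And>x. x \<in> carrier \<Gamma> \<Longrightarrow> t x \<in> carrier \<Gamma> \<and> t x \<otimes>\<^bsub>\<Gamma>\<^esub> s = x"
  shows "null_homologous \<Gamma> S f (\<lambda>x. u x - u (t x))"
proof -
  obtain K where K: "0 \<le> K" "\<And>x. x \<in> carrier \<Gamma> \<Longrightarrow>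
      side d (card (supp (fst x))) \<le> K * f (word_dist \<Gamma> S x \<one>\<^bsub>\<Gamma>\<^esub>)"
    using side_le_growth by blast
  have "\<bar>u x\<bar> \<le> (M * K) * f (word_dist \<Gamma> S x \<one>\<^bsub>\<Gamma>\<^esub>)" if "x \<in> carrier \<Gamma>" for x
    using order_trans[OF u[OF that] mult_left_mono[OF K(2)[OF that] s(2)]] by (simp add: mult.assoc)
  then have "null_homologous \<Gamma> S f (\<lambda>x. u x - u (x \<otimes>\<^bsub>\<Gamma>\<^esub> inv\<^bsub>\<Gamma>\<^esub> s))"
    using W.null_homologous_translate[OF s(1) mono_f, of "M * K"] s(2) K(1) by simp
  moreover have "t x = x \<otimes>\<^bsub>\<Gamma>\<^esub> inv\<^bsub>\<Gamma>\<^esub> s" if "x \<in> carrier \<Gamma>" for x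
    using t[OF that] s(1) that by (metis W.inv_solve_right)
  ultimately show ?thesis
    by (auto intro: null_homologous_cong)
qed

text \<open>Right multiplication by a unit vector with trivial lamps shifts the position by one in
  direction \<open>i\<close> and leaves \<open>\<phi>\<close> alone; \<open>u \<phi> k\<close> is
  the mass sent along that edge.\<close>

lemma null_homologous_move:
  fixes u :: "((nat \<Rightarrow> int) \<Rightarrow> 'a) \<Rightarrow> (nat \<Rightarrow> int) \<Rightarrow> real" and M :: real
  assumes i: "i < d" and M: "0 \<le> M"
    and u: "\<And>\<phi> k. \<phi> \<in> lamps \<Longrightarrow> k \<in> sites \<Longrightarrow> \<bar>u \<phi> k\<bar> \<le> M * side d (card (supp \<phi>))"
  shows "null_homologous \<Gamma> S f (\<lambda>(\<phi>, k). u \<phi> k - u \<phi> (k(i := k i - 1)))"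
proof -
  let ?e = "\<lambda>j\<in>{..<d}. if j = i then 1 else 0"
  let ?s = "(\<lambda>_\<in>sites. \<one>\<^bsub>F\<^esub>, ?e)"
  have s: "?s \<in> carrier \<Gamma>"
    by (auto simp: carrier_\<Gamma> lamps_def supp_def)
  have "(\<phi>, k(i := k i - 1)) \<otimes>\<^bsub>\<Gamma>\<^esub> ?s = (\<phi>, k)" if \<phi>: "\<phi> \<in> lamps" and k: "k \<in> sites" for \<phi> k
  proof -
    let ?k = "k(i := k i - 1)"
    have k': "?k \<in> sites"
      using k i by (rule PiE_UNIV_fun_upd)
    have "inv\<^bsub>int_power_group d\<^esub> ?k \<otimes>\<^bsub>int_power_group d\<^esub> x \<in> sites" if "x \<in> sites" for x
      using k' that unfolding carrier_sites[symmetric] by simp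
    then have "(\<lambda>x\<in>sites. \<phi> x \<otimes>\<^bsub>F\<^esub> (\<lambda>_\<in>sites. \<one>\<^bsub>F\<^esub>) (inv\<^bsub>int_power_group d\<^esub> ?k \<otimes>\<^bsub>int_power_group d\<^esub> x))
        = restrict \<phi> sites"
      using \<phi> by (intro restrict_ext) simp
    also have "\<dots> = \<phi>"
      using \<phi> by (rule restrict_lamps)
    moreover have "?k \<otimes>\<^bsub>int_power_group d\<^esub> ?e = restrict k {..<d}"
      by (auto simp: int_power_group_def)
    moreover have "restrict k {..<d} = k"
      using k by (rule PiE_restrict)
    ultimately show ?thesis by (simp only: mult_\<Gamma>)
  qed
  then have "null_homologous \<Gamma> S f (\<lambda>x. (\<lambda>(\<phi>, k). u \<phi> k) x - (\<lambda>(\<phi>, k). u \<phi> k) ((\<lambda>(\<phi>, k). (\<phi>, k(i := k i - 1))) x))"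
    by (intro null_homologous_step[OF s M]) (auto simp: carrier_\<Gamma> u simp del: PiE_iff intro!: PiE_UNIV_fun_upd[OF _ i])
  then show ?thesis
    by (simp add: case_prod_beta')
qed

lemma lamps_update:
  assumes "\<phi> \<in> lamps" "k \<in> sites" "h \<in> carrier F"
  shows "\<phi>(k := h) \<in> lamps"
proof -
  have "supp (\<phi>(k := h)) \<subseteq> insert k (supp \<phi>)"
    by (auto simp: supp_def)
  then have "finite (supp (\<phi>(k := h)))"
    using assms(1) by (auto simp: lamps_def intro: finite_subset)
  moreover have "\<phi>(k := h) \<in> sites \<rightarrow>\<^sub>E carrier F"
    using assms PiE_fun_upd[of h "\<lambda>_. carrier F" k \<phi> sites]
    by (simp add: lamps_def insert_absorb)
  ultimately show ?thesis by (simp add: lamps_def)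
qed

text \<open>Right multiplication by the configuration with \<open>g\<close> at the origin multiplies
  the lamp at the current position by \<open>g\<close>. A bounded flow satisfies the growth
  condition because every side is at least 1.\<close>

lemma null_homologous_switch:
  fixes v :: "((nat \<Rightarrow> int) \<Rightarrow> 'a) \<Rightarrow> (nat \<Rightarrow> int) \<Rightarrow> real" and M :: real
  assumes M: "0 \<le> M" and v: "\<And>\<phi> k. \<phi> \<in> lamps \<Longrightarrow> k \<in> sites \<Longrightarrow> \<bar>v \<phi> k\<bar> \<le> M"
  shows "null_homologous \<Gamma> S f (\<lambda>(\<phi>, k). v \<phi> k - v (\<phi>(k := \<phi> k \<otimes>\<^bsub>F\<^esub> inv\<^bsub>F\<^esub> g)) k)"
proof -
  let ?o = "\<one>\<^bsub>int_power_group d\<^esub>"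
  let ?\<delta> = "\<lambda>x\<in>sites. if x = ?o then g else \<one>\<^bsub>F\<^esub>"
  have o: "?o \<in> sites"
    using H.one_closed unfolding carrier_sites .
  have "supp ?\<delta> \<subseteq> {?o}" by (auto simp: supp_def)
  then have s: "(?\<delta>, ?o) \<in> carrier \<Gamma>"
    using g o finite_subset[of "supp ?\<delta>" "{?o}"] by (auto simp: carrier_\<Gamma> lamps_def)
  have "(\<phi>(k := \<phi> k \<otimes>\<^bsub>F\<^esub> inv\<^bsub>F\<^esub> g), k) \<otimes>\<^bsub>\<Gamma>\<^esub> (?\<delta>, ?o) = (\<phi>, k)" if \<phi>: "\<phi> \<in> lamps" and k: "k \<in> sites" for \<phi> k
  proof -
    let ?\<phi> = "\<phi>(k := \<phi> k \<otimes>\<^bsub>F\<^esub> inv\<^bsub>F\<^esub> g)"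
    have "?\<delta> (inv\<^bsub>int_power_group d\<^esub> k \<otimes>\<^bsub>int_power_group d\<^esub> x) = (if x = k then g else \<one>\<^bsub>F\<^esub>)" if x: "x \<in> sites" for x
    proof -
      have "inv\<^bsub>int_power_group d\<^esub> k \<otimes>\<^bsub>int_power_group d\<^esub> x \<in> sites"
        using k x unfolding carrier_sites[symmetric] by simp
      moreover have "inv\<^bsub>int_power_group d\<^esub> k \<otimes>\<^bsub>int_power_group d\<^esub> x = ?o \<longleftrightarrow> x = k"
        using k x unfolding carrier_sites[symmetric]
        by (metis H.inv_closed H.inv_solve_left' H.r_one H.one_closed)
      ultimately show ?thesis by simp
    qed
    then have "(\<lambda>x\<in>sites. ?\<phi> x \<otimes>\<^bsub>F\<^esub> ?\<delta> (inv\<^bsub>int_power_group d\<^esub> k \<otimes>\<^bsub>int_power_group d\<^esub> x)) = restrict \<phi> sites"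
      using \<phi> k g by (intro restrict_ext) (simp add: F.m_assoc)
    also have "\<dots> = \<phi>"
      using \<phi> by (rule restrict_lamps)
    moreover have "k \<otimes>\<^bsub>int_power_group d\<^esub> ?o = k"
      using k unfolding carrier_sites[symmetric] by simp
    ultimately show ?thesis by (simp only: mult_\<Gamma>)
  qed
  moreover have "\<bar>v \<phi> k\<bar> \<le> M * side d (card (supp \<phi>))" if "\<phi> \<in> lamps" "k \<in> sites" for \<phi> k
    using order_trans[OF v[OF that]] mult_left_mono[OF one_le_side M] by simp
  ultimately have "null_homologous \<Gamma> S f (\<lambda>x. (\<lambda>(\<phi>, k). v \<phi> k) x
      - (\<lambda>(\<phi>, k). v \<phi> k) ((\<lambda>(\<phi>, k). (\<phi>(k := \<phi> k \<otimes>\<^bsub>F\<^esub> inv\<^bsub>F\<^esub> g), k)) x))"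
    using g by (intro null_homologous_step[OF s M]) (auto simp: carrier_\<Gamma> intro!: lamps_update)
  then show ?thesis
    by (simp add: case_prod_beta')
qed

text \<open>Induction on the number of averaged coordinates, each step adding a levelling flow along
  one coordinate. These flows keep \<open>\<phi>\<close> fixed, so the box side is constant along
  them.\<close>

lemma null_homologous_average_diff:
  assumes h: "\<And>\<phi> k. \<phi> \<in> lamps \<Longrightarrow> k \<in> sites \<Longrightarrow> \<bar>h \<phi> k\<bar> \<le> M" and "0 \<le> M" and "m \<le> d"
  shows "null_homologous \<Gamma> S f (\<lambda>(\<phi>, k). h \<phi> k - average d m (side d (card (supp \<phi>))) (h \<phi>) k)"
  using \<open>m \<le> d\<close>
proof (induction m)
  case 0
  \<comment> \<open>Averaging over no coordinates changes nothing; the zero flow bounds the zero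
    function.\<close>
  have "null_homologous \<Gamma> S f (\<lambda>_. 0)"
    using null_homologous_move[OF d order_refl, of "\<lambda>_ _. 0"] by (simp add: case_prod_beta')
  then show ?case
    by (rule null_homologous_cong) (simp add: carrier_\<Gamma> average_0 case_prod_beta' mem_Times_iff)
next
  case (Suc m)
  then have m: "m < d" by simp
  let ?R = "\<lambda>\<phi>. side d (card (supp \<phi>))"
  \<comment> \<open>This evens out, along the line in direction \<open>m\<close> through
    \<open>k\<close>, the function already averaged in the earlier coordinates.\<close>
  define u where "u \<phi> k = block_flow (?R \<phi>) (\<lambda>t. average d m (?R \<phi>) (h \<phi>) (k(m := t))) (k m)" for \<phi> k
  have "\<bar>u \<phi> k\<bar> \<le> (2 * M) * ?R \<phi>" if "\<phi> \<in> lamps" "k \<in> sites" for \<phi> k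
  proof -
    have "\<bar>average d m (?R \<phi>) (h \<phi>) (k(m := t))\<bar> \<le> M" for t
      using that m h by (intro abs_average_le PiE_UNIV_fun_upd) auto
    then show ?thesis
      unfolding u_def using abs_block_flow_le[of "?R \<phi>"] by (simp add: mult.commute)
  qed
  then have "null_homologous \<Gamma> S f (\<lambda>(\<phi>, k). u \<phi> k - u \<phi> (k(m := k m - 1)))"
    using null_homologous_move[OF m, of "2 * M" u] \<open>0 \<le> M\<close> by simp
  moreover have "u \<phi> k - u \<phi> (k(m := k m - 1))
      = average d m (?R \<phi>) (h \<phi>) k - average d (Suc m) (?R \<phi>) (h \<phi>) k" for \<phi> k
    unfolding u_def using block_flow_diff[OF side_pos] m by (simp add: average_Suc)
  ultimately have "null_homologous \<Gamma> S f (\<lambda>(\<phi>, k).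
      average d m (?R \<phi>) (h \<phi>) k - average d (Suc m) (?R \<phi>) (h \<phi>) k)"
    by simp
  from W.null_homologous_add[OF S Suc.IH[OF less_imp_le[OF m]] this]
  show ?case by (simp add: case_prod_beta')
qed

section \<open>The flow through the switching edges\<close>

abbreviation box :: "nat \<Rightarrow> (nat \<Rightarrow> int) \<Rightarrow> (nat \<Rightarrow> int) set"
  where "box n k \<equiv> cell d d (side d n) k"

text \<open>The intensity is the amount pushed along the edge that switches the lamp at the current
  site from \<open>\<one>\<close> to \<open>g\<close>, for a lamp configuration with \<open>n\<close> lit lamps. It is constant on each box,
  and the formula is forced by the requirement that the net outflow through switching edges of
  a box is the number of its sites.\<close>

primrec intensity :: "nat \<Rightarrow> ((nat \<Rightarrow> int) \<Rightarrow> 'a) \<Rightarrow> (nat \<Rightarrow> int) \<Rightarrow> real"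
  where
    "intensity 0 = (\<lambda>\<phi> k. 1)"
  | "intensity (Suc n) = (\<lambda>\<phi> k.
      (card (box (Suc n) k) + (\<Sum>l\<in>{l \<in> box (Suc n) k. \<phi> l = g}. intensity n (\<phi>(l := \<one>\<^bsub>F\<^esub>)) l))
        / card {l \<in> box (Suc n) k. \<phi> l = \<one>\<^bsub>F\<^esub>})"

lemma lit_sites_le:
  assumes "\<phi> \<in> lamps" "card (supp \<phi>) = n"
  shows "4 * card {l \<in> box n k. \<phi> l \<noteq> \<one>\<^bsub>F\<^esub>} \<le> card (box n k)"
proof -
  have "{l \<in> box n k. \<phi> l \<noteq> \<one>\<^bsub>F\<^esub>} \<subseteq> supp \<phi>"
    unfolding supp_def using subsetD[OF cell_subset] by fast
  then have "card {l \<in> box n k. \<phi> l \<noteq> \<one>\<^bsub>F\<^esub>} \<le> n"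
    using assms by (metis (no_types, lifting) card_mono lamps_def mem_Collect_eq)
  then show ?thesis
    using side_power_ge[OF d, of n] by (simp add: card_full_cell)
qed

lemma card_box_pos: "0 < card (box n k)"
  by (simp add: card_full_cell)

lemma card_box_eq:
  "card (box n k) = card {l \<in> box n k. \<phi> l = \<one>\<^bsub>F\<^esub>} + card {l \<in> box n k. \<phi> l \<noteq> \<one>\<^bsub>F\<^esub>}"
  by (subst card_Un_disjoint[symmetric]) (auto intro!: arg_cong[of _ _ card])

lemma supp_switch_off:
  assumes "l \<in> sites" "\<phi> l = g"
  shows "l \<in> supp \<phi>" "supp (\<phi>(l := \<one>\<^bsub>F\<^esub>)) = supp \<phi> - {l}"
proof -
  show "l \<in> supp \<phi>"
    using assms g by (simp add: supp_def)
  have "k \<in> supp (\<phi>(l := \<one>\<^bsub>F\<^esub>)) \<longleftrightarrow> k \<in> supp \<phi> - {l}" for k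
    by (cases "k = l") (simp_all add: supp_def)
  then show "supp (\<phi>(l := \<one>\<^bsub>F\<^esub>)) = supp \<phi> - {l}"
    by blast
qed

lemma card_supp_switch_off:
  assumes "l \<in> sites" "\<phi> l = g"
  shows "card (supp (\<phi>(l := \<one>\<^bsub>F\<^esub>))) = card (supp \<phi>) - 1"
  using supp_switch_off[of l \<phi>, OF assms] by simp

text \<open>The bound 2 reproduces itself. With inflow at most 2 per lit site, the numerator is at
  most dark + 3 lit, and since lit sites form at most a quarter of the box, 3 lit is at most
  dark.\<close>

lemma intensity_bounds:
  assumes "\<phi> \<in> lamps" "card (supp \<phi>) = n"
  shows "0 \<le> intensity n \<phi> k \<and> intensity n \<phi> k \<le> 2"
  using assms
proof (induction n arbitrary: \<phi> k)
  case 0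
  then show ?case by simp
next
  case (Suc n)
  let ?Q = "box (Suc n) k"
  let ?lit = "{l \<in> ?Q. \<phi> l \<noteq> \<one>\<^bsub>F\<^esub>}" and ?dark = "{l \<in> ?Q. \<phi> l = \<one>\<^bsub>F\<^esub>}"
  let ?s = "\<Sum>l\<in>{l \<in> ?Q. \<phi> l = g}. intensity n (\<phi>(l := \<one>\<^bsub>F\<^esub>)) l"
  have IH: "0 \<le> intensity n (\<phi>(l := \<one>\<^bsub>F\<^esub>)) l \<and> intensity n (\<phi>(l := \<one>\<^bsub>F\<^esub>)) l \<le> 2"
    if "l \<in> ?Q" "\<phi> l = g" for l
  proof (rule Suc.IH)
    have l: "l \<in> sites" using that(1) cell_subset by blast
    show "\<phi>(l := \<one>\<^bsub>F\<^esub>) \<in> lamps" using Suc.prems(1) l by (simp add: lamps_update)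
    show "card (supp (\<phi>(l := \<one>\<^bsub>F\<^esub>))) = n"
      using card_supp_switch_off[of l \<phi>] l that(2) Suc.prems(2) by simp
  qed
  have "0 \<le> ?s" using IH by (intro sum_nonneg) blast
  have "?s \<le> (\<Sum>l\<in>{l \<in> ?Q. \<phi> l = g}. 2)" using IH by (intro sum_mono) blast
  also have "\<dots> \<le> (\<Sum>l\<in>?lit. 2)" using g by (intro sum_mono2) auto
  finally have s: "?s \<le> 2 * card ?lit" by simp
  have "4 * card ?lit \<le> card ?Q" by (rule lit_sites_le[OF Suc.prems])
  with s card_box_eq[of "Suc n" k \<phi>] card_box_pos[of "Suc n" k]
  have "card ?Q + ?s \<le> 2 * card ?dark" "0 < card ?dark" by linarith+
  then show ?case
    using \<open>0 \<le> ?s\<close> by (simp add: divide_le_eq)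
qed

text \<open>Outflow of a box equals its number of sites plus its inflow: the quotient defining the
  intensity, multiplied back by the number of dark sites.\<close>

lemma intensity_balance:
  assumes \<phi>: "\<phi> \<in> lamps" and n: "card (supp \<phi>) = n"
  shows "(\<Sum>l\<in>{l \<in> box n k. \<phi> l = \<one>\<^bsub>F\<^esub>}. intensity n \<phi> l)
    = card (box n k) + (\<Sum>l\<in>{l \<in> box n k. \<phi> l = g}. intensity (n - 1) (\<phi>(l := \<one>\<^bsub>F\<^esub>)) l)"
proof (cases n)
  case 0
  \<comment> \<open>With no lamp lit the inflow sum is empty, so the truncated index
    \<open>n - 1\<close> does no harm.\<close>
  then have "supp \<phi> = {}"
    using \<phi> n by (simp add: lamps_def)
  then have "\<phi> l = \<one>\<^bsub>F\<^esub>" if "l \<in> box n k" for l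
    using that cell_subset unfolding supp_def by blast
  then have "{l \<in> box n k. \<phi> l = \<one>\<^bsub>F\<^esub>} = box n k" "{l \<in> box n k. \<phi> l = g} = {}"
    using g(2) by (blast, metis (mono_tags, lifting) Collect_empty_eq)
  then show ?thesis using 0 by simp
next
  case (Suc m)
  let ?dark = "{l \<in> box n k. \<phi> l = \<one>\<^bsub>F\<^esub>}"
  \<comment> \<open>For positive \<open>n\<close> the intensity depends on the site only through its
    box.\<close>
  have "intensity n \<phi> l = intensity n \<phi> k" if "l \<in> box n k" for l
    unfolding Suc intensity.simps using full_cell_eq[OF side_pos that] unfolding Suc by simp
  then have "(\<Sum>l\<in>?dark. intensity n \<phi> l) = card ?dark * intensity n \<phi> k"
    by simp
  moreover have "0 < card ?dark"
    using lit_sites_le[OF \<phi> n, of k] card_box_eq[of n k \<phi>] card_box_pos[of n k] by linarith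
  moreover have "intensity n \<phi> k = (card (box n k)
      + (\<Sum>l\<in>{l \<in> box n k. \<phi> l = g}. intensity (n - 1) (\<phi>(l := \<one>\<^bsub>F\<^esub>)) l)) / card ?dark"
    by (simp add: Suc)
  ultimately show ?thesis
    by (simp only: times_divide_eq_right nonzero_mult_div_cancel_left of_nat_eq_0_iff)
qed

text \<open>The constant 1 is split as \<open>h\<close> plus \<open>v - w\<close>. The second
  summand is the boundary of the switching flow, and \<open>h\<close> has mean 0 on every box, so
  levelling alone disposes of it.\<close>

lemma fundamental_class_trivial:
  "fundamental_class \<Gamma> S f = \<one>\<^bsub>coarse_homology_group \<Gamma> S f 0\<^esub>"
proof -
  define v where "v \<phi> k = (if \<phi> k = \<one>\<^bsub>F\<^esub> then intensity (card (supp \<phi>)) \<phi> k else 0)" for \<phi> k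
  \<comment> \<open>The mass arriving through the switching edge that ends at
    \<open>(\<phi>, k)\<close>.\<close>
  define w where "w \<phi> k = v (\<phi>(k := \<phi> k \<otimes>\<^bsub>F\<^esub> inv\<^bsub>F\<^esub> g)) k" for \<phi> k
  define h where "h \<phi> k = 1 - (v \<phi> k - w \<phi> k)" for \<phi> k
  have v: "0 \<le> v \<phi> k" "v \<phi> k \<le> 2" if "\<phi> \<in> lamps" for \<phi> k
    using intensity_bounds[OF that refl, of k] by (auto simp: v_def)
  have w: "0 \<le> w \<phi> k" "w \<phi> k \<le> 2" if "\<phi> \<in> lamps" "k \<in> sites" for \<phi> k
    using v[OF lamps_update[OF that, of "\<phi> k \<otimes>\<^bsub>F\<^esub> inv\<^bsub>F\<^esub> g"]] that g by (simp_all add: w_def)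
  \<comment> \<open>The edge starts at a dark lamp exactly when it ends at \<open>g\<close>, and its
    source then has one lit lamp fewer. This is the inflow term of
    \<open>intensity_balance\<close>.\<close>
  have w_eq: "w \<phi> k = (if \<phi> k = g then intensity (card (supp \<phi>) - 1) (\<phi>(k := \<one>\<^bsub>F\<^esub>)) k else 0)"
    if "\<phi> \<in> lamps" "k \<in> sites" for \<phi> k
  proof (cases "\<phi> k = g")
    case True
    then show ?thesis
      using card_supp_switch_off[of k \<phi>, OF that(2) True] g by (simp add: w_def v_def)
  next
    case False
    then have "\<phi> k \<otimes>\<^bsub>F\<^esub> inv\<^bsub>F\<^esub> g \<noteq> \<one>\<^bsub>F\<^esub>"
      using that g by (metis F.inv_equality F.inv_inv F.inv_closed lamps_closed)
    then show ?thesis using False by (simp add: w_def v_def)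
  qed
  have avg: "average d d (side d (card (supp \<phi>))) (h \<phi>) k = 0" if \<phi>: "\<phi> \<in> lamps" for \<phi> k
  proof -
    let ?Q = "box (card (supp \<phi>)) k"
    have "sum (v \<phi>) ?Q = (\<Sum>l\<in>?Q. if \<phi> l = \<one>\<^bsub>F\<^esub> then intensity (card (supp \<phi>)) \<phi> l else 0)"
      by (rule sum.cong[OF refl v_def])
    also have "\<dots> = (\<Sum>l\<in>{l \<in> ?Q. \<phi> l = \<one>\<^bsub>F\<^esub>}. intensity (card (supp \<phi>)) \<phi> l)"
      by (rule sum.inter_filter[symmetric]) simp
    also have "\<dots> = card ?Q + (\<Sum>l\<in>{l \<in> ?Q. \<phi> l = g}. intensity (card (supp \<phi>) - 1) (\<phi>(l := \<one>\<^bsub>F\<^esub>)) l)"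
      by (rule intensity_balance[OF \<phi> refl])
    also have "(\<Sum>l\<in>{l \<in> ?Q. \<phi> l = g}. intensity (card (supp \<phi>) - 1) (\<phi>(l := \<one>\<^bsub>F\<^esub>)) l) = sum (w \<phi>) ?Q"
    proof (subst sum.inter_filter)
      show "(\<Sum>l\<in>?Q. if \<phi> l = g then intensity (card (supp \<phi>) - 1) (\<phi>(l := \<one>\<^bsub>F\<^esub>)) l else 0) = sum (w \<phi>) ?Q"
        by (intro sum.cong refl w_eq[OF \<phi>, symmetric] subsetD[OF cell_subset])
    qed simp
    finally have "sum (h \<phi>) ?Q = 0"
      by (simp add: h_def sum_subtractf)
    then show ?thesis by (simp add: average_def)
  qed
  have "\<bar>h \<phi> k\<bar> \<le> 3" if "\<phi> \<in> lamps" "k \<in> sites" for \<phi> k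
    using v[OF that(1), of k] w[OF that] by (simp add: h_def)
  then have "null_homologous \<Gamma> S f (\<lambda>(\<phi>, k). h \<phi> k - average d d (side d (card (supp \<phi>))) (h \<phi>) k)"
    by (rule null_homologous_average_diff) auto
  then have "null_homologous \<Gamma> S f (\<lambda>(\<phi>, k). h \<phi> k)"
    by (rule null_homologous_cong) (simp add: avg carrier_\<Gamma> case_prod_beta' mem_Times_iff)
  moreover have "null_homologous \<Gamma> S f (\<lambda>(\<phi>, k). v \<phi> k - w \<phi> k)"
    unfolding w_def using v by (intro null_homologous_switch[of 2]) simp_all
  ultimately have "null_homologous \<Gamma> S f (\<lambda>_. 1)"
    by (rule null_homologous_cong[OF W.null_homologous_add[OF S]]) (simp add: h_def case_prod_beta')
  then show ?thesis
    by (rule W.fundamental_class_eq_one[OF S])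
qed

end

theorem corollary5p1:
  fixes F :: "('a, 'b) monoid_scheme"
    and d :: nat
    and S :: "(((nat \<Rightarrow> int) \<Rightarrow> 'a) \<times> (nat \<Rightarrow> int)) set"
  defines "\<Gamma> \<equiv> wreath_product F (int_power_group d)"
    and "f \<equiv> (\<lambda>t::real. 1 + t powr (1 / real d))"
  assumes "group F" and "finite (carrier F)" and "\<not> trivial_group F"
    and "d \<ge> 2"
    and "finite_symmetric_generating_set \<Gamma> S"
  shows "fundamental_class \<Gamma> S f = \<one>\<^bsub>coarse_homology_group \<Gamma> S f 0\<^esub>"
proof -
  interpret F: group F by fact
  \<comment> \<open>Any nontrivial element can serve as the lit state.\<close>
  obtain g where "g \<in> carrier F" "g \<noteq> \<one>\<^bsub>F\<^esub>"
    using \<open>\<not> trivial_group F\<close> F.is_group by (auto simp: trivial_group_def)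
  then interpret lamplighter F d S g
    using assms by unfold_locales auto
  show ?thesis
    unfolding \<Gamma>_def f_def by (rule fundamental_class_trivial)
qed

end
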